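(* Let $I_d\subseteq\{1,\ldots,d\}$ be given for every $d\in\mathbb{N}$, and let $$N^* := N^*(d,I_d) := (\# I_d+1)\cdot 2^{d-\# I_d},\qquad d\in\mathbb{N}.$$ Then, for all $d\in\mathbb{N}$ and $\alpha>1$: (i) for every integer $N$ with $0\le N<N^*$, $$e\big(N,d;\mathrm{Int}_d,\mathfrak{S}_{I_d}(E_{d,\alpha})\big)=1;$$ (ii) $$e\big(N^*,d;\mathrm{Int}_d,\mathfrak{S}_{I_d}(E_{d,\alpha})\big)\le\left(1+\frac{\zeta(\alpha)}{2^{\alpha-1}}\right)^d-1.$$ Consequently, for all $d\in\mathbb{N}$, $$\lim_{\alpha\to\infty}e\big(N^*,d;\mathrm{Int}_d,\mathfrak{S}_{I_d}(E_{d,\alpha})\big)=0.$$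
   Context: Notation: $\mathbb{N}=\{1,2,\ldots\}$, $\mathbb{N}_0=\{0\}\cup\mathbb{N}$, $\#I$ is the cardinality of $I$, $\zeta(s)=\sum_{m=1}^\infty m^{-s}$ for $s>1$. For $f\in L_1([0,1]^d)$ (complex-valued) and $\boldsymbol{k}\in\mathbb{Z}^d$ let $\widehat f(\boldsymbol{k})=\int_{[0,1]^d}f(\boldsymbol{x})e^{-2\pi\mathrm{i}\,\boldsymbol{k}\boldsymbol{x}}\,\mathrm{d}\boldsymbol{x}$, where $\boldsymbol{k}\boldsymbol{x}=\sum_{m=1}^d k_mx_m$. For $k\in\mathbb{Z}$ put $\overline{k}:=\max\{1,|k|\}$. Korobov class: for $d\in\mathbb{N}$ and $\alpha>1$, $$E_{d,\alpha}:=\Big\{f\in L_1([0,1]^d) : \|f\|:=\sup_{\boldsymbol{k}\in\mathbb{Z}^d}|\widehat f(\boldsymbol{k})|\,(\overline{k_1}\cdots\overline{k_d})^\alpha<\infty\Big\}.$$ Every $f\in E_{d,\alpha}$ has an absolutely convergent Fourier series and is identified with the ($1$-periodic, continuous) function given by that series, so function values are well defined. Permutation-invariance: for $I_d\subseteq\{1,\ldots,d\}$ let $\mathcal{S}_{I_d}$ be the set of all bijections $\sigma$ of $\{1,\ldots,d\}$ that fix every element of $\{1,\ldots,d\}\setminus I_d$, acting on vectors by $\sigma(\boldsymbol{x})=(x_{\sigma(1)},\ldots,x_{\sigma(d)})$. $\mathfrak{S}_{I_d}(E_{d,\alpha})$ is the subspace of all $f\in E_{d,\alpha}$ with $f(\boldsymbol{x})=f(\sigma(\boldsymbol{x}))$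 for all $\boldsymbol{x}\in[0,1]^d$ and all $\sigma\in\mathcal{S}_{I_d}$, equipped with the norm of $E_{d,\alpha}$. Integration: $\mathrm{Int}_d(f)=\int_{[0,1]^d}f(\boldsymbol{x})\,\mathrm{d}\boldsymbol{x}$. A linear cubature rule using at most $N\in\mathbb{N}_0$ function values is $\mathcal{A}_{N,d}(f)=\sum_{n=1}^N w_n f(\boldsymbol{t}^{(n)})$ with arbitrary weights $w_n\in\mathbb{C}$ and nodes $\boldsymbol{t}^{(n)}\in[0,1]^d$ (for $N=0$ it is the zero functional). For a normed space $F$ of such functions the $N$th minimal worst case error is $$e(N,d;\mathrm{Int}_d,F):=\inf_{\mathcal{A}_{N,d}}\ \sup_{f\in F,\ \|f\|_F\le1}|\mathrm{Int}_d(f)-\mathcal{A}_{N,d}(f)|,$$ the infimum being over all such rules. *)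

theory Defs
  imports "HOL-Analysis.Analysis" "HOL-Combinatorics.Permutations"
begin

text \<open>
  Points of $[0,1]^d$ and frequencies in $\mathbb{Z}^d$ are extensional functions on the
  index set \<open>{1..d}\<close>, so that $d$ can be an ordinary natural number. A function on $[0,1]^d$ is
  any \<open>f :: (nat \<Rightarrow> real) \<Rightarrow> complex\<close>; its values outside \<open>cube d\<close> are never used.
\<close>

definition cube :: "nat \<Rightarrow> (nat \<Rightarrow> real) set" where
  "cube d = {1..d} \<rightarrow>\<^sub>E {0..1}"

definition freqs :: "nat \<Rightarrow> (nat \<Rightarrow> int) set" where
  "freqs d = {1..d} \<rightarrow>\<^sub>E UNIV"

definition cube_measure :: "nat \<Rightarrow> (nat \<Rightarrow> real) measure" where
  "cube_measure d = PiM {1..d} (\<lambda>_. restrict_space lborel {0..1})"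

lemma space_cube_measure: "space (cube_measure d) = cube d"
  by (simp add: cube_measure_def cube_def space_PiM space_restrict_space)

definition Int_cube :: "nat \<Rightarrow> ((nat \<Rightarrow> real) \<Rightarrow> complex) \<Rightarrow> complex" where
  "Int_cube d f = (LINT x|cube_measure d. f x)"

definition freq_dot :: "nat \<Rightarrow> (nat \<Rightarrow> int) \<Rightarrow> (nat \<Rightarrow> real) \<Rightarrow> real" where
  "freq_dot d k x = (\<Sum>m=1..d. of_int (k m) * x m)"

definition fourier_coeff :: "nat \<Rightarrow> ((nat \<Rightarrow> real) \<Rightarrow> complex) \<Rightarrow> (nat \<Rightarrow> int) \<Rightarrow> complex" where
  "fourier_coeff d f k =
     (LINT x|cube_measure d. f x * exp (- (2 * of_real pi * \<i> * of_real (freq_dot d k x))))"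

definition korobov_norm :: "nat \<Rightarrow> real \<Rightarrow> ((nat \<Rightarrow> real) \<Rightarrow> complex) \<Rightarrow> ereal" where
  "korobov_norm d \<alpha> f =
     (SUP k\<in>freqs d.
        ereal (norm (fourier_coeff d f k) * (\<Prod>m=1..d. of_int (max 1 \<bar>k m\<bar>)) powr \<alpha>))"

text \<open>
  Elements of the Korobov class are $L_1$ equivalence classes, each identified with the sum of its
  absolutely convergent Fourier series. The last conjunct below selects this representative, which
  gives point evaluation its meaning. (For complex series over a countable index set,
  unconditional convergence \<open>has_sum\<close> is the same as absolute convergence.)
\<close>

definition korobov_space :: "nat \<Rightarrow> real \<Rightarrow> ((nat \<Rightarrow> real) \<Rightarrow> complex) set" where
  "korobov_space d \<alpha> =
     {f. integrable (cube_measure d) f \<and> korobov_norm d \<alpha> f < \<infinity> \<and>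
         (\<forall>x\<in>cube d.
            ((\<lambda>k. fourier_coeff d f k * exp (2 * of_real pi * \<i> * of_real (freq_dot d k x)))
               has_sum f x) (freqs d))}"

definition coord_perms :: "nat \<Rightarrow> nat set \<Rightarrow> (nat \<Rightarrow> nat) set" where
  "coord_perms d I = {\<sigma>. \<sigma> permutes {1..d} \<and> (\<forall>i\<in>{1..d} - I. \<sigma> i = i)}"

definition perm_invariant ::
  "nat \<Rightarrow> nat set \<Rightarrow> ((nat \<Rightarrow> real) \<Rightarrow> complex) set \<Rightarrow> ((nat \<Rightarrow> real) \<Rightarrow> complex) set" where
  "perm_invariant d I F =
     {f\<in>F. \<forall>x\<in>cube d. \<forall>\<sigma>\<in>coord_perms d I. f x = f (\<lambda>i\<in>{1..d}. x (\<sigma> i))}"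

definition cubature ::
  "nat \<Rightarrow> (nat \<Rightarrow> complex) \<Rightarrow> (nat \<Rightarrow> nat \<Rightarrow> real) \<Rightarrow> ((nat \<Rightarrow> real) \<Rightarrow> complex) \<Rightarrow> complex" where
  "cubature N w t f = (\<Sum>n=1..N. w n * f (t n))"

text \<open>
  Suprema and infima are taken in the extended reals, so that no boundedness has to be assumed for
  them to be meaningful.
\<close>

definition min_error ::
  "nat \<Rightarrow> nat \<Rightarrow> ((nat \<Rightarrow> real) \<Rightarrow> complex) set \<Rightarrow> (((nat \<Rightarrow> real) \<Rightarrow> complex) \<Rightarrow> ereal) \<Rightarrow> ereal" where
  "min_error N d F nrm =
     (INF (w, t) \<in> {(w, t). \<forall>n\<in>{1..N}. t n \<in> cube d}.
        SUP f\<in>{f\<in>F. nrm f \<le> 1}. ereal (norm (Int_cube d f - cubature N w t f)))"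

definition korobov_error :: "nat \<Rightarrow> nat \<Rightarrow> nat set \<Rightarrow> real \<Rightarrow> ereal" where
  "korobov_error N d I \<alpha> =
     min_error N d (perm_invariant d I (korobov_space d \<alpha>)) (korobov_norm d \<alpha>)"

definition N_star :: "nat \<Rightarrow> nat set \<Rightarrow> nat" where
  "N_star d I = (card I + 1) * 2 ^ (d - card I)"

definition zeta :: "real \<Rightarrow> real" where
  "zeta s = (\<Sum>m. real (Suc m) powr (- s))"

end

theory Submission
  imports Defs "HOL-Real_Asymp.Real_Asymp"
begin

text \<open>
  Both halves rest on the same count: under coordinate permutations inside $I_d$, the $2^d$ vertices
  of \<open>{0,1}\<^sup>d\<close> fall into exactly $N^* = (\#I_d+1)\,2^{d-\#I_d}$ orbits, because a vertex is determined
  up to permutation by its number of ones inside $I_d$ and its entries outside $I_d$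
  (\<open>same_orbit_type_imp_permuted\<close>, \<open>card_orbit_types\<close>).

  \<^emph>\<open>Too few nodes.\<close> Read the vertices as frequencies. The trigonometric polynomials with
  frequencies in \<open>{0,1}\<^sup>d\<close> whose coefficients are constant on orbits form a space of dimension $N^*$,
  so fewer than $N^*$ nodes leave a nonzero $g$ in it vanishing at all of them. Scale $g$ so that
  its largest coefficient is $1$, attained at $h_0$. Then
  $g(x)\,\overline{e_{h_0}(x)}$ has mean $1$, its frequencies lie in \<open>{-1,0,1}\<^sup>d\<close> where the Korobov
  weight is $1$ whatever $\alpha$ is, and so its norm is $1$; but it is no longer symmetric. Averaging the
  factor $\overline{e_{h_0}}$ over the permutations restores symmetry and changes neither the mean,
  nor the zeros, nor the bound on the norm (\<open>fooling_function\<close>). A cubature rule using these nodes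
  cannot tell this function from $0$, so its error is at least $1$; the zero rule has error at
  most $1$.

  \<^emph>\<open>Enough nodes.\<close> Read the vertices, divided by two, as nodes. The equal-weight rule on
  \<open>{0,1/2}\<^sup>d\<close> integrates each character exactly except those whose frequencies are all even and
  not all zero, where it returns $1$. On the unit ball the error is thus at most the sum of
  $\prod_m \overline{k_m}^{-\alpha}$ over the nonzero even $k$, which factorizes into
  $(1 + 2\sum_{m\ge1}(2m)^{-\alpha})^d - 1$ (\<open>rectangle_rule_error\<close>). On symmetric functions, nodes
  in the same orbit carry equal values and can be merged, leaving $N^*$ nodes
  (\<open>rectangle_rule_as_cubature\<close>). The bound tends to $0$ because $\zeta$ is bounded on
  $[2,\infty)$.
\<close>

section \<open>Characters and trigonometric polynomials\<close>

definition character :: "nat \<Rightarrow> (nat \<Rightarrow> int) \<Rightarrow> (nat \<Rightarrow> real) \<Rightarrow> complex" where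
  "character d k x = exp (2 * of_real pi * \<i> * of_real (freq_dot d k x))"

abbreviation zero_freq :: "nat \<Rightarrow> nat \<Rightarrow> int" where
  "zero_freq d \<equiv> (\<lambda>_\<in>{1..d}. 0)"

abbreviation permute_coords :: "nat \<Rightarrow> (nat \<Rightarrow> nat) \<Rightarrow> (nat \<Rightarrow> 'a) \<Rightarrow> nat \<Rightarrow> 'a" where
  "permute_coords d \<sigma> x \<equiv> (\<lambda>i\<in>{1..d}. x (\<sigma> i))"

lemma character_mult:
  "character d k x * character d l x = character d (\<lambda>m\<in>{1..d}. k m + l m) x"
proof -
  have "freq_dot d (\<lambda>m\<in>{1..d}. k m + l m) x = freq_dot d k x + freq_dot d l x"
    by (simp add: freq_dot_def algebra_simps sum.distrib)
  thus ?thesis by (simp add: character_def exp_add[symmetric] algebra_simps)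
qed

lemma character_minus:
  "character d (\<lambda>m\<in>{1..d}. - k m) x = exp (- (2 * of_real pi * \<i> * of_real (freq_dot d k x)))"
proof -
  have "freq_dot d (\<lambda>m\<in>{1..d}. - k m) x = - freq_dot d k x"
    by (simp add: freq_dot_def sum_negf)
  thus ?thesis by (simp add: character_def)
qed

text \<open>
  Permuting the coordinates of the point amounts to permuting those of the frequency by the inverse;
  this is how symmetry of a function becomes symmetry of its coefficients.
\<close>

lemma character_permute:
  assumes "\<sigma> permutes {1..d}"
  shows "character d k (permute_coords d \<sigma> x) = character d (permute_coords d (inv \<sigma>) k) x"
proof -
  have "freq_dot d k (permute_coords d \<sigma> x) = (\<Sum>m=1..d. of_int (k m) * x (\<sigma> m))"
    by (simp add: freq_dot_def)
  also have "\<dots> = (\<Sum>m=1..d. of_int (k (inv \<sigma> m)) * x m)"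
    using assms
    by (intro sum.reindex_bij_witness[where i = "inv \<sigma>" and j = \<sigma>])
       (auto simp: permutes_inverses permutes_in_image permutes_inv dest: permutes_inv
             simp del: atLeastAtMost_iff)
  also have "\<dots> = freq_dot d (permute_coords d (inv \<sigma>) k) x"
    by (simp add: freq_dot_def)
  finally show ?thesis by (simp add: character_def)
qed

lemma character_eq_prod:
  "character d k x = (\<Prod>m=1..d. exp (2 * of_real pi * \<i> * of_int (k m) * of_real (x m)))"
  by (simp add: character_def freq_dot_def exp_sum[symmetric] sum_distrib_left mult.assoc)

lemma integrable_exponential:
  "integrable (restrict_space lborel {0..1::real})
     (\<lambda>t. exp (2 * of_real pi * \<i> * of_int k * of_real t) :: complex)"
  by (subst integrable_restrict_space)
     (auto intro!: borel_integrable_compact continuous_intros simp del: of_real_mult)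

lemma integral_exponential:
  "(LINT t|restrict_space lborel {0..1::real}.
      exp (2 * of_real pi * \<i> * of_int k * of_real t) :: complex) = of_bool (k = 0)"
proof (cases "k = 0")
  case True
  thus ?thesis
    by (simp add: measure_restrict_space)
next
  case False
  define c :: complex where "c = 2 * of_real pi * \<i> * of_int k"
  have c: "c \<noteq> 0" using False by (simp add: c_def)
  have "(LINT t|restrict_space lborel {0..1::real}. exp (c * of_real t))
        = (LINT t|lborel. indicator {0..1} t *\<^sub>R exp (c * of_real t))"
    by (subst integral_restrict_space) auto
  also have "\<dots> = exp (c * of_real 1) / c - exp (c * of_real 0) / c"
  proof (rule integral_FTC_atLeastAtMost)
    show "((\<lambda>t. exp (c * of_real t) / c) has_vector_derivative exp (c * of_real x))
            (at x within {0..1})" for x :: real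
    proof -
      have "((\<lambda>z. exp (c * z) / c) has_field_derivative exp (c * of_real x)) (at (of_real x))"
        using c by (auto intro!: derivative_eq_intros)
      from has_vector_derivative_real_field[OF this] show ?thesis
        by (simp add: o_def has_vector_derivative_at_within)
    qed
  qed (auto intro!: continuous_intros)
  also have "exp (c * of_real 1) = 1"
    using exp_integer_2pi[of "of_int k"] by (simp add: c_def mult_ac)
  finally show ?thesis using False by (simp add: c_def)
qed

interpretation unit_interval_product: product_sigma_finite
  "\<lambda>_::nat. restrict_space lborel {0..1::real}"
  by (rule product_sigma_finite.intro)
     (rule sigma_finite_measure_restrict_space, auto intro: sigma_finite_lborel)

lemma integrable_character: "integrable (cube_measure d) (character d k)"
  unfolding character_eq_prod cube_measure_def
  by (rule unit_interval_product.product_integrable_prod) (auto intro: integrable_exponential)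

lemma integral_character:
  assumes "k \<in> freqs d"
  shows "(LINT x|cube_measure d. character d k x) = of_bool (k = zero_freq d)"
proof -
  have "(LINT x|cube_measure d. character d k x) = (\<Prod>m=1..d. of_bool (k m = 0))"
    unfolding character_eq_prod cube_measure_def
    by (subst unit_interval_product.product_integral_prod)
       (auto intro: integrable_exponential simp: integral_exponential)
  also have "\<dots> = of_bool (\<forall>m\<in>{1..d}. k m = 0)"
    by (auto simp: prod_zero_iff)
  also have "(\<forall>m\<in>{1..d}. k m = 0) \<longleftrightarrow> k = zero_freq d"
    using assms unfolding freqs_def by (auto simp: fun_eq_iff PiE_def extensional_def)
  finally show ?thesis .
qed

lemma Int_cube_eq_fourier_coeff: "Int_cube d f = fourier_coeff d f (zero_freq d)"
  by (simp add: Int_cube_def fourier_coeff_def freq_dot_def)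

lemma norm_fourier_coeff_le:
  assumes "korobov_norm d \<alpha> f \<le> 1" "k \<in> freqs d"
  shows "norm (fourier_coeff d f k) \<le> (\<Prod>m=1..d. of_int (max 1 \<bar>k m\<bar>)) powr (-\<alpha>)"
proof -
  let ?P = "\<Prod>m=1..d. of_int (max 1 \<bar>k m\<bar>) :: real"
  have "ereal (norm (fourier_coeff d f k) * ?P powr \<alpha>) \<le> korobov_norm d \<alpha> f"
    unfolding korobov_norm_def by (rule SUP_upper) fact
  also have "\<dots> \<le> ereal 1" using assms unfolding one_ereal_def by simp
  finally have *: "norm (fourier_coeff d f k) * ?P powr \<alpha> \<le> 1"
    by simp
  have "?P > 0" by (rule prod_pos) auto
  hence "?P powr \<alpha> > 0" by (metis powr_gt_zero less_irrefl)
  with * have "norm (fourier_coeff d f k) \<le> 1 / ?P powr \<alpha>"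
    by (simp only: pos_le_divide_eq)
  thus ?thesis by (simp only: powr_minus_divide)
qed

lemma norm_Int_cube_le:
  assumes "korobov_norm d \<alpha> f \<le> 1"
  shows "norm (Int_cube d f) \<le> 1"
  using norm_fourier_coeff_le[OF assms, of "zero_freq d"]
  by (simp add: Int_cube_eq_fourier_coeff freqs_def)

text \<open>
  The frequencies \<open>\<kappa> j\<close> may repeat: the index set of the fooling function below consists of pairs
  of a vertex and a permutation, and different pairs can give the same frequency.
\<close>

lemma fourier_coeff_trig_poly:
  assumes "finite J" "\<kappa> ` J \<subseteq> freqs d" "k \<in> freqs d"
  shows "fourier_coeff d (\<lambda>x. \<Sum>j\<in>J. c j * character d (\<kappa> j) x) k
           = (\<Sum>j\<in>J. if \<kappa> j = k then c j else 0)"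
proof -
  let ?\<kappa> = "\<lambda>j. (\<lambda>m\<in>{1..d}. \<kappa> j m + (\<lambda>m\<in>{1..d}. - k m) m)"
  have 0: "?\<kappa> j = zero_freq d \<longleftrightarrow> \<kappa> j = k" if "j \<in> J" for j
  proof -
    have "\<kappa> j \<in> freqs d" using that assms by auto
    with assms(3) show ?thesis
      unfolding freqs_def by (auto simp: fun_eq_iff PiE_def extensional_def) (metis)
  qed
  have "fourier_coeff d (\<lambda>x. \<Sum>j\<in>J. c j * character d (\<kappa> j) x) k
      = (LINT x|cube_measure d. (\<Sum>j\<in>J. c j * character d (?\<kappa> j) x))"
    unfolding fourier_coeff_def character_minus[symmetric]
    by (simp only: sum_distrib_right mult.assoc character_mult)
  also have "\<dots> = (\<Sum>j\<in>J. c j * (LINT x|cube_measure d. character d (?\<kappa> j) x))"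
    by (simp add: integrable_character)
  also have "\<dots> = (\<Sum>j\<in>J. if \<kappa> j = k then c j else 0)"
  proof (rule sum.cong)
    fix j assume "j \<in> J"
    have "?\<kappa> j \<in> freqs d" by (auto simp: freqs_def)
    from integral_character[OF this] 0[OF \<open>j \<in> J\<close>]
    show "c j * (LINT x|cube_measure d. character d (?\<kappa> j) x) = (if \<kappa> j = k then c j else 0)"
      by simp
  qed simp
  finally show ?thesis .
qed

lemma trig_poly_in_korobov_space:
  assumes "finite J" "\<kappa> ` J \<subseteq> freqs d"
  shows "(\<lambda>x. \<Sum>j\<in>J. c j * character d (\<kappa> j) x) \<in> korobov_space d \<alpha>"
proof -
  define f where "f = (\<lambda>x. \<Sum>j\<in>J. c j * character d (\<kappa> j) x)"
  have coeff: "fourier_coeff d f k = (\<Sum>j\<in>J. if \<kappa> j = k then c j else 0)" if "k \<in> freqs d" for k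
    unfolding f_def using assms that by (rule fourier_coeff_trig_poly)
  have coeff0: "fourier_coeff d f k = 0" if "k \<in> freqs d - \<kappa> ` J" for k
    using that by (subst coeff) (auto intro!: sum.neutral)
  have "integrable (cube_measure d) f"
    unfolding f_def
    by (intro Bochner_Integration.integrable_sum integrable_mult_right integrable_character)
  moreover have "korobov_norm d \<alpha> f < \<infinity>"
  proof -
    let ?T = "\<lambda>k. norm (fourier_coeff d f k) * (\<Prod>m=1..d. of_int (max 1 \<bar>k m\<bar>)) powr \<alpha>"
    have "?T k \<le> (\<Sum>l\<in>\<kappa> ` J. ?T l)" if "k \<in> freqs d" for k
    proof (cases "k \<in> \<kappa> ` J")
      case True
      show ?thesis by (rule member_le_sum) (use True assms in auto)
    next
      case False
      with that have "?T k = 0" using coeff0 by auto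
      also have "0 \<le> (\<Sum>l\<in>\<kappa> ` J. ?T l)" by (intro sum_nonneg) auto
      finally show ?thesis .
    qed
    hence "korobov_norm d \<alpha> f \<le> ereal (\<Sum>l\<in>\<kappa> ` J. ?T l)"
      unfolding korobov_norm_def by (intro SUP_least) (simp only: ereal_less_eq)
    thus ?thesis by (rule le_less_trans) simp
  qed
  moreover have "((\<lambda>k. fourier_coeff d f k * character d k x) has_sum f x) (freqs d)" for x
  proof (rule has_sum_finite_neutralI)
    have "(\<Sum>k\<in>\<kappa> ` J. fourier_coeff d f k * character d k x)
        = (\<Sum>k\<in>\<kappa> ` J. \<Sum>j\<in>J. if k = \<kappa> j then c j * character d k x else 0)"
    proof (rule sum.cong)
      fix k assume "k \<in> \<kappa> ` J"
      with assms(2) have "k \<in> freqs d" by blast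
      thus "fourier_coeff d f k * character d k x
          = (\<Sum>j\<in>J. if k = \<kappa> j then c j * character d k x else 0)"
        by (auto simp: coeff sum_distrib_right intro!: sum.cong)
    qed simp
    also have "\<dots> = (\<Sum>j\<in>J. \<Sum>k\<in>\<kappa> ` J. if k = \<kappa> j then c j * character d k x else 0)"
      by (rule sum.swap)
    also have "\<dots> = f x"
      using assms by (simp add: f_def)
    finally show "f x = (\<Sum>k\<in>\<kappa> ` J. fourier_coeff d f k * character d k x)" ..
  qed (use assms coeff0 in auto)
  ultimately show ?thesis
    by (auto simp: korobov_space_def character_def f_def)
qed

section \<open>Homogeneous linear systems\<close>

text \<open>
  Gaussian elimination: the last equation eliminates an unknown \<open>p\<close> that occurs in it, and the
  remaining \<open>N\<close> equations still have more unknowns than there are equations.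
\<close>

lemma homogeneous_system_solution:
  fixes A :: "nat \<Rightarrow> 'j \<Rightarrow> 'a::field"
  assumes "finite J" "N < card J"
  shows "\<exists>a. (\<exists>j\<in>J. a j \<noteq> 0) \<and> (\<forall>n\<in>{1..N}. (\<Sum>j\<in>J. a j * A n j) = 0)"
  using assms
proof (induction N arbitrary: J A)
  case 0
  then have "J \<noteq> {}" by auto
  thus ?case by (intro exI[of _ "\<lambda>_. 1"]) auto
next
  case (Suc N)
  show ?case
  proof (cases "\<forall>j\<in>J. A (Suc N) j = 0")
    case True
    from Suc.IH[of J A] Suc.prems obtain a where
      "\<exists>j\<in>J. a j \<noteq> 0" "\<forall>n\<in>{1..N}. (\<Sum>j\<in>J. a j * A n j) = 0" by auto
    with True show ?thesis
      by (intro exI[of _ a]) (auto simp: le_Suc_eq)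
  next
    case False
    then obtain p where p: "p \<in> J" "A (Suc N) p \<noteq> 0" by blast
    define B where "B n j = A n j - A n p * A (Suc N) j / A (Suc N) p" for n j
    have "N < card (J - {p})" using Suc.prems p by simp
    with Suc.IH[of "J - {p}" B] Suc.prems obtain b where
      b: "\<exists>j\<in>J - {p}. b j \<noteq> 0" "\<forall>n\<in>{1..N}. (\<Sum>j\<in>J - {p}. b j * B n j) = 0"
      by auto
    define s where "s = (\<Sum>j\<in>J - {p}. b j * A (Suc N) j)"
    \<comment> \<open>the value of the eliminated unknown is forced by the last equation\<close>
    define a where "a = b(p := - s / A (Suc N) p)"
    have sum_a: "(\<Sum>j\<in>J. a j * A n j)
        = - s / A (Suc N) p * A n p + (\<Sum>j\<in>J - {p}. b j * A n j)" for n
    proof -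
      have "(\<Sum>j\<in>J. a j * A n j) = a p * A n p + (\<Sum>j\<in>J - {p}. a j * A n j)"
        using Suc.prems p by (subst sum.remove[of J p]) auto
      also have "(\<Sum>j\<in>J - {p}. a j * A n j) = (\<Sum>j\<in>J - {p}. b j * A n j)"
        by (intro sum.cong) (auto simp: a_def)
      finally show ?thesis by (simp add: a_def)
    qed
    have sum_B: "(\<Sum>j\<in>J - {p}. b j * B n j)
        = (\<Sum>j\<in>J - {p}. b j * A n j) - s / A (Suc N) p * A n p" for n
      by (simp add: B_def s_def algebra_simps sum_subtractf sum_divide_distrib sum_distrib_left
                    sum_distrib_right)
    have "(\<Sum>j\<in>J. a j * A n j) = 0" if "n \<in> {1..Suc N}" for n
    proof (cases "n = Suc N")
      case True
      thus ?thesis using p by (simp add: sum_a s_def)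
    next
      case False
      with that b(2) have "(\<Sum>j\<in>J - {p}. b j * B n j) = 0" by auto
      thus ?thesis by (simp add: sum_a sum_B)
    qed
    moreover have "\<exists>j\<in>J. a j \<noteq> 0" using b(1) by (auto simp: a_def)
    ultimately show ?thesis by blast
  qed
qed

text \<open>
  Dividing by an entry of largest modulus.
\<close>

lemma homogeneous_system_normalized_solution:
  fixes A :: "nat \<Rightarrow> 'j \<Rightarrow> 'a::real_normed_field"
  assumes "finite J" "N < card J"
  obtains a p where "p \<in> J" "a p = 1" "\<And>j. j \<in> J \<Longrightarrow> norm (a j) \<le> 1"
    "\<And>n. n \<in> {1..N} \<Longrightarrow> (\<Sum>j\<in>J. a j * A n j) = 0"
proof -
  obtain a where a: "\<exists>j\<in>J. a j \<noteq> 0" "\<forall>n\<in>{1..N}. (\<Sum>j\<in>J. a j * A n j) = 0"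
    using homogeneous_system_solution[OF assms] by blast
  have "\<exists>p\<in>J. \<forall>j\<in>J. norm (a j) \<le> norm (a p)"
  proof -
    have "J \<noteq> {}" using a by auto
    with assms have "Max ((norm \<circ> a) ` J) \<in> (norm \<circ> a) ` J" by (intro Max_in) auto
    then obtain p where p: "p \<in> J" "Max ((norm \<circ> a) ` J) = norm (a p)" by auto
    have "norm (a j) \<le> norm (a p)" if "j \<in> J" for j
      using that assms unfolding p(2)[symmetric] by (intro Max_ge) auto
    with p show ?thesis by auto
  qed
  then obtain p where p: "p \<in> J" "\<And>j. j \<in> J \<Longrightarrow> norm (a j) \<le> norm (a p)" by auto
  with a have "a p \<noteq> 0" by force
  show ?thesis
  proof (rule that[of p "\<lambda>j. a j / a p"])
    show "(\<Sum>j\<in>J. a j / a p * A n j) = 0" if "n \<in> {1..N}" for n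
      using a(2) that by (simp add: sum_divide_distrib[symmetric])
  qed (use p \<open>a p \<noteq> 0\<close> in \<open>auto simp: norm_divide\<close>)
qed

section \<open>Orbits of cube vertices\<close>

lemma coord_perms_eq:
  assumes "I \<subseteq> {1..d}"
  shows "coord_perms d I = {\<sigma>. \<sigma> permutes I}"
proof (intro set_eqI iffI)
  fix \<sigma> assume "\<sigma> \<in> coord_perms d I"
  hence "\<sigma> permutes {1..d}" "\<forall>i\<in>{1..d} - I. \<sigma> i = i"
    by (auto simp: coord_perms_def)
  hence "\<sigma> permutes I" by (intro permutes_superset[of \<sigma> "{1..d}" I]) (auto split: if_splits)
  thus "\<sigma> \<in> {\<sigma>. \<sigma> permutes I}" by simp
next
  fix \<sigma> assume "\<sigma> \<in> {\<sigma>. \<sigma> permutes I}"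
  thus "\<sigma> \<in> coord_perms d I"
    using assms permutes_subset[of \<sigma> I "{1..d}"] by (auto simp: coord_perms_def permutes_not_in)
qed

text \<open>
  Vertices are integer vectors because they serve both as frequencies and, halved, as nodes.
\<close>

definition corners :: "nat \<Rightarrow> (nat \<Rightarrow> int) set" where
  "corners d = {1..d} \<rightarrow>\<^sub>E {0, 1}"

text \<open>
  A complete invariant of the orbit of a vertex under permutations of the coordinates in \<open>I\<close>; the
  next lemmas show that it is invariant, that it separates orbits, and which values it takes.
\<close>

definition orbit_type :: "nat \<Rightarrow> nat set \<Rightarrow> (nat \<Rightarrow> int) \<Rightarrow> nat \<times> (nat \<Rightarrow> int)" where
  "orbit_type d I h = (card {i\<in>I. h i = 1}, restrict h ({1..d} - I))"

lemma finite_corners [simp]: "finite (corners d)"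
  by (simp add: corners_def finite_PiE)

lemma permute_coords_corners:
  assumes "\<sigma> permutes {1..d}" "h \<in> corners d"
  shows "permute_coords d \<sigma> h \<in> corners d"
proof -
  have "h (\<sigma> i) \<in> {0, 1}" if "i \<in> {1..d}" for i
    using assms that permutes_in_image[OF assms(1)] unfolding corners_def by blast
  thus ?thesis unfolding corners_def by auto
qed

lemma orbit_type_permute:
  assumes "I \<subseteq> {1..d}" "\<sigma> permutes I"
  shows "orbit_type d I (permute_coords d \<sigma> h) = orbit_type d I h"
proof -
  have "bij_betw \<sigma> {i\<in>I. h (\<sigma> i) = 1} {i\<in>I. h i = 1}"
    using assms
    by (intro bij_betwI[where g = "inv \<sigma>"])
       (auto simp: permutes_inverses permutes_in_image dest: permutes_inv)
  hence "card {i\<in>I. h (\<sigma> i) = 1} = card {i\<in>I. h i = 1}" by (rule bij_betw_same_card)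
  moreover have "{i\<in>I. permute_coords d \<sigma> h i = 1} = {i\<in>I. h (\<sigma> i) = 1}"
    using assms(1) by auto
  moreover have "restrict (permute_coords d \<sigma> h) ({1..d} - I) = restrict h ({1..d} - I)"
    using assms by (auto simp: fun_eq_iff restrict_def permutes_not_in)
  ultimately show ?thesis by (simp add: orbit_type_def)
qed

text \<open>
  Equally many ones inside \<open>I\<close> means that \<open>h\<close> and \<open>h'\<close> have the same multiset of entries there, so
  some permutation of \<open>I\<close> carries one to the other; outside \<open>I\<close> they agree anyway.
\<close>

lemma same_orbit_type_imp_permuted:
  assumes I: "I \<subseteq> {1..d}" and h: "h \<in> corners d" "h' \<in> corners d"
    and eq: "orbit_type d I h = orbit_type d I h'"
  obtains \<sigma> where "\<sigma> permutes I" "h = permute_coords d \<sigma> h'"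
proof -
  have fin: "finite I" using I by (rule finite_subset) simp
  have bits: "h i \<in> {0, 1}" "h' i \<in> {0, 1}" if "i \<in> I" for i
    using PiE_mem[OF h(1)[unfolded corners_def], of i] PiE_mem[OF h(2)[unfolded corners_def], of i]
      I that by auto
  have count: "card {i\<in>I. u i = b}
      = (if b = 1 then card {i\<in>I. u i = 1} else if b = 0 then card I - card {i\<in>I. u i = 1} else 0)"
    if u: "\<And>i. i \<in> I \<Longrightarrow> u i \<in> {0, 1::int}" for u b
  proof -
    have "{i\<in>I. u i = 0} = I - {i\<in>I. u i = 1}" using u by force
    hence zero: "card {i\<in>I. u i = 0} = card I - card {i\<in>I. u i = 1}"
      using fin by (simp add: card_Diff_subset)
    have other: "{i\<in>I. u i = b} = {}" if "b \<noteq> 0" "b \<noteq> 1" using u that by force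
    consider "b = 1" | "b = 0" | "b \<noteq> 0" "b \<noteq> 1" by blast
    thus ?thesis
    proof cases
      case 2
      thus ?thesis using zero by simp
    next
      case 3
      thus ?thesis unfolding other[OF 3] by simp
    qed simp
  qed
  have same: "card {i\<in>I. h i = 1} = card {i\<in>I. h' i = 1}"
    using eq by (simp add: orbit_type_def)
  have "card {i\<in>I. h i = b} = card {i\<in>I. h' i = b}" for b
    by (rule trans[OF count[OF bits(1)] trans[OF _ count[OF bits(2), symmetric]]])
       (simp_all only: same)
  hence "image_mset h (mset_set I) = image_mset h' (mset_set I)"
    using fin by (intro multiset_eqI) (simp only: count_image_mset_eq_card_vimage)
  from image_mset_eq_implies_permutes[OF fin this] obtain \<sigma> where
    \<sigma>: "\<sigma> permutes I" "\<forall>i\<in>I. h i = h' (\<sigma> i)" by blast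
  have rest: "restrict h ({1..d} - I) = restrict h' ({1..d} - I)"
    using eq by (simp add: orbit_type_def)
  have "h i = permute_coords d \<sigma> h' i" for i
  proof -
    consider "i \<in> I" | "i \<in> {1..d} - I" | "i \<notin> {1..d}" by blast
    thus ?thesis
    proof cases
      case 1
      hence "h i = h' (\<sigma> i)" "i \<in> {1..d}" using \<sigma>(2) I by blast+
      thus ?thesis by (simp only: restrict_apply if_True)
    next
      case 2
      hence "h i = h' i" using fun_cong[OF rest, of i] by (simp only: restrict_apply if_True)
      moreover have "\<sigma> i = i" using 2 by (intro permutes_not_in[OF \<sigma>(1)]) blast
      ultimately show ?thesis using 2 by (simp only: restrict_apply if_True Diff_iff)
    next
      case 3
      hence "h i = undefined" using PiE_arb[OF h(1)[unfolded corners_def]] by blast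
      with 3 show ?thesis by (simp only: restrict_apply if_False)
    qed
  qed
  with \<sigma>(1) show ?thesis by (intro that[of \<sigma>]) auto
qed

lemma orbit_type_image:
  assumes I: "I \<subseteq> {1..d}"
  shows "orbit_type d I ` corners d = {..card I} \<times> (({1..d} - I) \<rightarrow>\<^sub>E {0, 1})"
proof (intro equalityI subsetI)
  have fin: "finite I" using I by (rule finite_subset) simp
  fix c assume "c \<in> orbit_type d I ` corners d"
  then obtain h where h: "h \<in> corners d" "c = orbit_type d I h" by auto
  have "card {i\<in>I. h i = 1} \<le> card I" using fin by (intro card_mono) auto
  thus "c \<in> {..card I} \<times> (({1..d} - I) \<rightarrow>\<^sub>E {0, 1})"
    using h unfolding orbit_type_def corners_def by auto
next
  fix c :: "nat \<times> (nat \<Rightarrow> int)"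
  assume "c \<in> {..card I} \<times> (({1..d} - I) \<rightarrow>\<^sub>E {0, 1})"
  then obtain j u where c: "c = (j, u)" "j \<le> card I" "u \<in> ({1..d} - I) \<rightarrow>\<^sub>E {0, 1}" by auto
  obtain A where A: "A \<subseteq> I" "card A = j"
    using c(2) by (meson obtain_subset_with_card_n)
  define h :: "nat \<Rightarrow> int" where "h = (\<lambda>i\<in>{1..d}. if i \<in> I then of_bool (i \<in> A) else u i)"
  have "u i \<in> {0, 1}" if "i \<in> {1..d} - I" for i using c(3) that by blast
  hence "h \<in> corners d" unfolding h_def corners_def by auto
  moreover have "{i\<in>I. h i = 1} = A" using A I by (auto simp: h_def)
  moreover have "restrict h ({1..d} - I) = u"
    using c(3) by (auto simp: h_def fun_eq_iff PiE_def extensional_def)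
  ultimately show "c \<in> orbit_type d I ` corners d"
    using A c(1) by (intro image_eqI[of _ _ h]) (auto simp: orbit_type_def)
qed

lemma card_orbit_types:
  assumes "I \<subseteq> {1..d}"
  shows "card (orbit_type d I ` corners d) = N_star d I"
proof -
  have "finite I" using assms by (rule finite_subset) simp
  thus ?thesis unfolding orbit_type_image[OF assms] N_star_def
    using assms by (simp add: card_cartesian_product card_PiE card_Diff_subset numeral_2_eq_2)
qed

section \<open>Fooling functions\<close>

lemma permutes_superset_cube:
  assumes "I \<subseteq> {1..d}" "\<sigma> permutes I"
  shows "\<sigma> permutes {1..d}"
  using assms by (rule permutes_subset[rotated])

text \<open>
  The zero function makes the suprema in the worst case error range over a nonempty set; in the
  extended reals an empty supremum would be $-\infty$.
\<close>

lemma zero_function_admissible: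
  "(\<lambda>_. 0) \<in> perm_invariant d I (korobov_space d \<alpha>)"
  "korobov_norm d \<alpha> (\<lambda>_. 0) = 0"
proof -
  have "(\<lambda>_. 0) \<in> korobov_space d \<alpha>"
    using trig_poly_in_korobov_space[of "{}" undefined d undefined \<alpha>] by simp
  thus "(\<lambda>_. 0) \<in> perm_invariant d I (korobov_space d \<alpha>)"
    by (simp add: perm_invariant_def)
  have "freqs d \<noteq> {}" by (auto simp: freqs_def PiE_eq_empty_iff)
  thus "korobov_norm d \<alpha> (\<lambda>_. 0) = 0"
    by (simp add: korobov_norm_def fourier_coeff_def zero_ereal_def[symmetric])
qed

text \<open>
  Write $e_k$ for the character of frequency $k$, $\sigma k$ for \<open>permute_coords d \<sigma> k\<close>, and $S$ for
  the permutations of \<open>I\<close>. The function is $f = g \cdot A$, where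
  $g = \sum_h a_h e_h$ has coefficients depending only on the orbit of $h$ and vanishes at the
  nodes, and $A$ is the average of $e_{-\sigma h_0}$ over $\sigma \in S$, with $h_0$ a vertex where
  $a_{h_0} = 1$ is largest. Both factors are symmetric. The coefficient of $f$ at $k$ is the average
  over $\sigma$ of $a_{k + \sigma h_0}$, an entry being $0$ when $k + \sigma h_0$ is not a vertex:
  at $k = 0$ every term is $a_{\sigma h_0} = a_{h_0} = 1$, and in general a nonzero term forces
  $k \in \{-1,0,1\}^d$, where the weight of the norm is $1$.
\<close>

lemma fooling_function:
  assumes I: "I \<subseteq> {1..d}" and N: "N < N_star d I"
  obtains f where "f \<in> perm_invariant d I (korobov_space d \<alpha>)" "korobov_norm d \<alpha> f \<le> 1"
    "Int_cube d f = 1" "\<And>n. n \<in> {1..N} \<Longrightarrow> f (t n) = 0"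
proof -
  let ?type = "orbit_type d I"
  define S where "S = {\<sigma>. \<sigma> permutes I}"
  have finI: "finite I" using I by (rule finite_subset) simp
  have finS: "finite S" unfolding S_def using finI by (rule finite_permutations)
  have cardS: "card S > 0" using finS by (auto simp: card_gt_0_iff S_def intro: permutes_id)
  have S_cube: "\<sigma> permutes {1..d}" if "\<sigma> \<in> S" for \<sigma>
    using that I permutes_superset_cube unfolding S_def by blast
  have S_inv: "inv \<sigma> \<in> S" if "\<sigma> \<in> S" for \<sigma>
    using that unfolding S_def by (auto intro: permutes_inv)
  \<comment> \<open>one unknown per orbit, one equation per node\<close>
  have few: "finite (?type ` corners d)" "N < card (?type ` corners d)"
    using N by (simp_all add: card_orbit_types[OF I])
  obtain b p where p: "p \<in> ?type ` corners d" "b p = 1"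
    and b_le: "\<And>c. c \<in> ?type ` corners d \<Longrightarrow> norm (b c) \<le> 1"
    and b_sum: "\<And>n. n \<in> {1..N} \<Longrightarrow>
       (\<Sum>c\<in>?type ` corners d. b c * (\<Sum>h\<in>{h\<in>corners d. ?type h = c}. character d h (t n))) = 0"
    by (rule homogeneous_system_normalized_solution[OF few,
          of "\<lambda>n c. \<Sum>h\<in>{h\<in>corners d. ?type h = c}. character d h (t n)"]) (rule that)
  then obtain h\<^sub>0 where h0: "h\<^sub>0 \<in> corners d" "?type h\<^sub>0 = p" by auto
  define a where "a h = b (?type h)" for h
  have a_le: "norm (a h) \<le> 1" if "h \<in> corners d" for h
    using that b_le by (auto simp: a_def)
  have a_permute: "a (permute_coords d \<sigma> h) = a h" if "\<sigma> \<in> S" for \<sigma> h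
    using that orbit_type_permute[OF I, of \<sigma> h] by (simp add: a_def S_def)
  define g where "g x = (\<Sum>h\<in>corners d. a h * character d h x)" for x
  have g_nodes: "g (t n) = 0" if "n \<in> {1..N}" for n
  proof -
    have "g (t n) = (\<Sum>c\<in>?type ` corners d. \<Sum>h\<in>{h\<in>corners d. ?type h = c}. a h * character d h (t n))"
      unfolding g_def by (rule sum.image_gen) simp
    also have "\<dots> = (\<Sum>c\<in>?type ` corners d. b c * (\<Sum>h\<in>{h\<in>corners d. ?type h = c}. character d h (t n)))"
      by (intro sum.cong refl) (simp add: a_def sum_distrib_left)
    finally show ?thesis using b_sum[OF that] by simp
  qed
  have g_permute: "g (permute_coords d \<tau> x) = g x" if "\<tau> \<in> S" for \<tau> x
  proof -
    have \<tau>: "\<tau> permutes {1..d}" "inv \<tau> permutes {1..d}"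
      using S_cube S_inv that by auto
    have cancel: "permute_coords d (inv \<tau>) (permute_coords d \<tau> h) = h"
      "permute_coords d \<tau> (permute_coords d (inv \<tau>) h) = h" if "h \<in> corners d" for h
      using that permutes_in_image[OF \<tau>(1)] permutes_in_image[OF \<tau>(2)] permutes_inverses[OF \<tau>(1)]
      by (auto simp: corners_def fun_eq_iff PiE_def extensional_def simp del: atLeastAtMost_iff)
    have "g (permute_coords d \<tau> x)
        = (\<Sum>h\<in>corners d. a h * character d (permute_coords d (inv \<tau>) h) x)"
      by (simp only: g_def character_permute[OF \<tau>(1)])
    also have "\<dots> = g x"
      unfolding g_def
      by (rule sum.reindex_bij_witness[where i = "permute_coords d \<tau>" and j = "permute_coords d (inv \<tau>)"])
         (simp_all only: cancel permute_coords_corners[OF \<tau>(1)] permute_coords_corners[OF \<tau>(2)]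
            a_permute[OF S_inv[OF that]])
    finally show ?thesis .
  qed
  define \<nu> where "\<nu> \<sigma> = (\<lambda>m\<in>{1..d}. - h\<^sub>0 (\<sigma> m))" for \<sigma> :: "nat \<Rightarrow> nat"
  define A where "A x = (\<Sum>\<sigma>\<in>S. character d (\<nu> \<sigma>) x) / of_nat (card S)" for x
  have A_permute: "A (permute_coords d \<tau> x) = A x" if "\<tau> \<in> S" for \<tau> x
  proof -
    have \<tau>: "\<tau> permutes {1..d}" "inv \<tau> permutes {1..d}"
      using S_cube S_inv that by auto
    have "permute_coords d (inv \<tau>) (\<nu> \<sigma>) = \<nu> (\<sigma> \<circ> inv \<tau>)" for \<sigma>
      using permutes_in_image[OF \<tau>(2)]
      by (auto simp: \<nu>_def fun_eq_iff simp del: atLeastAtMost_iff)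
    hence "(\<Sum>\<sigma>\<in>S. character d (\<nu> \<sigma>) (permute_coords d \<tau> x))
        = (\<Sum>\<sigma>\<in>S. character d (\<nu> (\<sigma> \<circ> inv \<tau>)) x)"
      by (simp only: character_permute[OF \<tau>(1)])
    also have "\<dots> = (\<Sum>\<sigma>\<in>S. character d (\<nu> \<sigma>) x)"
      using S_inv[OF that] unfolding S_def
      by (intro sum_permutations_compose_right[symmetric]) simp
    finally show ?thesis by (simp add: A_def)
  qed
  define f where "f x = g x * A x" for x
  define \<kappa> where "\<kappa> = (\<lambda>(h, \<sigma>). (\<lambda>m\<in>{1..d}. h m + \<nu> \<sigma> m))"
  define c where "c = (\<lambda>(h, \<sigma> :: nat \<Rightarrow> nat). a h / of_nat (card S))"
  have f_eq: "f = (\<lambda>x. \<Sum>j\<in>corners d \<times> S. c j * character d (\<kappa> j) x)"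
  proof
    fix x
    have "f x = (\<Sum>h\<in>corners d. \<Sum>\<sigma>\<in>S.
        (a h * character d h x) * (character d (\<nu> \<sigma>) x / of_nat (card S)))"
      by (simp only: f_def g_def A_def sum_divide_distrib sum_product)
    also have "\<dots> = (\<Sum>h\<in>corners d. \<Sum>\<sigma>\<in>S. c (h, \<sigma>) * character d (\<kappa> (h, \<sigma>)) x)"
      by (intro sum.cong refl) (simp add: c_def \<kappa>_def character_mult)
    finally show "f x = (\<Sum>j\<in>corners d \<times> S. c j * character d (\<kappa> j) x)"
      by (simp add: sum.cartesian_product case_prod_unfold)
  qed
  have \<kappa>_freqs: "\<kappa> ` (corners d \<times> S) \<subseteq> freqs d"
    by (auto simp: \<kappa>_def freqs_def)
  define shift where "shift k \<sigma> = (\<lambda>m\<in>{1..d}. k m + h\<^sub>0 (\<sigma> m))" for k and \<sigma> :: "nat \<Rightarrow> nat"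
  have coeff: "fourier_coeff d f k
      = (\<Sum>\<sigma>\<in>S. if shift k \<sigma> \<in> corners d then a (shift k \<sigma>) else 0) / of_nat (card S)"
    if k: "k \<in> freqs d" for k
  proof -
    have \<kappa>_iff: "\<kappa> (h, \<sigma>) = k \<longleftrightarrow> h = shift k \<sigma>" if "h \<in> corners d" for h \<sigma>
      using that k unfolding corners_def freqs_def \<kappa>_def shift_def \<nu>_def
      by (auto simp: fun_eq_iff PiE_def extensional_def restrict_def)
    have "fourier_coeff d f k = (\<Sum>j\<in>corners d \<times> S. if \<kappa> j = k then c j else 0)"
      unfolding f_eq using finS \<kappa>_freqs k by (intro fourier_coeff_trig_poly) auto
    also have "\<dots> = (\<Sum>h\<in>corners d. \<Sum>\<sigma>\<in>S. if \<kappa> (h, \<sigma>) = k then c (h, \<sigma>) else 0)"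
      by (simp add: sum.cartesian_product case_prod_unfold cong: if_cong)
    also have "\<dots> = (\<Sum>\<sigma>\<in>S. \<Sum>h\<in>corners d. if h = shift k \<sigma> then c (h, \<sigma>) else 0)"
      by (subst sum.swap) (intro sum.cong refl, simp add: \<kappa>_iff)
    also have "\<dots> = (\<Sum>\<sigma>\<in>S. (if shift k \<sigma> \<in> corners d then a (shift k \<sigma>) else 0) / of_nat (card S))"
      by (intro sum.cong refl) (simp add: c_def)
    finally show ?thesis by (simp only: sum_divide_distrib)
  qed
  have "f \<in> korobov_space d \<alpha>"
    unfolding f_eq using finS \<kappa>_freqs by (intro trig_poly_in_korobov_space) auto
  moreover have "f (permute_coords d \<sigma> x) = f x" if "\<sigma> \<in> S" for \<sigma> x
    using g_permute[OF that] A_permute[OF that] by (simp only: f_def)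
  ultimately have "f \<in> perm_invariant d I (korobov_space d \<alpha>)"
    by (simp add: perm_invariant_def coord_perms_eq[OF I] S_def)
  moreover have "korobov_norm d \<alpha> f \<le> 1"
  proof -
    have "norm (fourier_coeff d f k) * (\<Prod>m=1..d. of_int (max 1 \<bar>k m\<bar>)) powr \<alpha> \<le> 1"
      if k: "k \<in> freqs d" for k
    proof -
      let ?P = "(\<Prod>m=1..d. of_int (max 1 \<bar>k m\<bar>)) powr \<alpha>"
      \<comment> \<open>the bound holds for each permutation separately and passes to the average\<close>
      let ?e = "\<lambda>\<sigma>. if shift k \<sigma> \<in> corners d then a (shift k \<sigma>) else 0"
      have le: "norm (?e \<sigma>) * ?P \<le> 1" if "\<sigma> \<in> S" for \<sigma>
      proof (cases "shift k \<sigma> \<in> corners d")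
        case True
        \<comment> \<open>a difference of two vertices has entries in \<open>{-1, 0, 1}\<close>\<close>
        have "max 1 \<bar>k m\<bar> = 1" if m: "m \<in> {1..d}" for m
        proof -
          have "\<sigma> m \<in> {1..d}"
            using m permutes_in_image[OF S_cube[OF \<open>\<sigma> \<in> S\<close>]] by blast
          hence "h\<^sub>0 (\<sigma> m) \<in> {0, 1}"
            by (rule PiE_mem[OF h0(1)[unfolded corners_def]])
          moreover have "k m + h\<^sub>0 (\<sigma> m) \<in> {0, 1}"
            using PiE_mem[OF True[unfolded corners_def] m] m by (simp add: shift_def)
          ultimately show ?thesis by auto
        qed
        hence "?P = 1" by simp
        with True show ?thesis using a_le by simp
      qed simp
      have "norm (fourier_coeff d f k) * ?P = norm (\<Sum>\<sigma>\<in>S. ?e \<sigma>) * ?P / of_nat (card S)"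
        by (simp only: coeff[OF k] norm_divide norm_of_nat times_divide_eq_left)
      also have "\<dots> \<le> (\<Sum>\<sigma>\<in>S. norm (?e \<sigma>)) * ?P / of_nat (card S)"
        by (intro divide_right_mono mult_right_mono norm_sum) auto
      also have "\<dots> = (\<Sum>\<sigma>\<in>S. norm (?e \<sigma>) * ?P) / of_nat (card S)"
        by (simp only: sum_distrib_right)
      also have "\<dots> \<le> (\<Sum>\<sigma>\<in>S. 1) / of_nat (card S)"
        by (intro divide_right_mono sum_mono le) auto
      also have "\<dots> = 1" using cardS by simp
      finally show ?thesis .
    qed
    thus ?thesis
      unfolding korobov_norm_def one_ereal_def by (intro SUP_least) (simp only: ereal_less_eq)
  qed
  moreover have "Int_cube d f = 1"
  proof -
    have "shift (zero_freq d) \<sigma> = permute_coords d \<sigma> h\<^sub>0" for \<sigma>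
      by (auto simp: shift_def)
    moreover have "permute_coords d \<sigma> h\<^sub>0 \<in> corners d" "a (permute_coords d \<sigma> h\<^sub>0) = 1" if "\<sigma> \<in> S" for \<sigma>
      using that permute_coords_corners[OF S_cube h0(1)] a_permute p h0 by (auto simp: a_def)
    moreover have "zero_freq d \<in> freqs d" by (simp add: freqs_def)
    ultimately show ?thesis
      using cardS by (simp add: Int_cube_eq_fourier_coeff coeff)
  qed
  moreover have "f (t n) = 0" if "n \<in> {1..N}" for n
    using g_nodes[OF that] by (simp add: f_def)
  ultimately show ?thesis by (rule that)
qed

text \<open>
  The rule with all weights zero has error at most $1$, the integral being the Fourier coefficient at
  frequency zero.
\<close>

lemma korobov_error_le_1: "korobov_error N d I \<alpha> \<le> 1"
  unfolding korobov_error_def min_error_def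
proof (rule INF_lower2)
  show "(\<lambda>_. 0, \<lambda>_. \<lambda>_\<in>{1..d}. 0) \<in> {(w, t). \<forall>n\<in>{1..N}. t n \<in> cube d}"
    by (auto simp: cube_def)
  show "(case (\<lambda>_. 0, \<lambda>_. \<lambda>_\<in>{1..d}. 0) of (w, t) \<Rightarrow>
          SUP f\<in>{f \<in> perm_invariant d I (korobov_space d \<alpha>). korobov_norm d \<alpha> f \<le> 1}.
            ereal (norm (Int_cube d f - cubature N w t f))) \<le> 1"
    using norm_Int_cube_le by (auto intro!: SUP_least simp: cubature_def one_ereal_def)
qed

lemma korobov_error_nonneg: "0 \<le> korobov_error N d I \<alpha>"
  unfolding korobov_error_def min_error_def
proof (rule INF_greatest, clarify)
  fix w t
  show "0 \<le> (SUP f\<in>{f \<in> perm_invariant d I (korobov_space d \<alpha>). korobov_norm d \<alpha> f \<le> 1}.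
            ereal (norm (Int_cube d f - cubature N w t f)))"
    by (rule SUP_upper2[of "\<lambda>_. 0"]) (auto simp: zero_function_admissible)
qed

lemma korobov_error_eq_1:
  assumes "I \<subseteq> {1..d}" "N < N_star d I"
  shows "korobov_error N d I \<alpha> = 1"
proof (rule antisym[OF korobov_error_le_1])
  show "1 \<le> korobov_error N d I \<alpha>"
    unfolding korobov_error_def min_error_def
  proof (rule INF_greatest, clarify)
    fix w t
    obtain f where f: "f \<in> perm_invariant d I (korobov_space d \<alpha>)" "korobov_norm d \<alpha> f \<le> 1"
      "Int_cube d f = 1" "\<And>n. n \<in> {1..N} \<Longrightarrow> f (t n) = 0"
      using fooling_function[OF assms] by metis
    show "1 \<le> (SUP f\<in>{f \<in> perm_invariant d I (korobov_space d \<alpha>). korobov_norm d \<alpha> f \<le> 1}.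
              ereal (norm (Int_cube d f - cubature N w t f)))"
      by (rule SUP_upper2[of f]) (use f in \<open>auto simp: cubature_def one_ereal_def\<close>)
  qed
qed

section \<open>The rectangle rule with step one half\<close>

definition half_point :: "nat \<Rightarrow> (nat \<Rightarrow> int) \<Rightarrow> nat \<Rightarrow> real" where
  "half_point d h = (\<lambda>i\<in>{1..d}. of_int (h i) / 2)"

lemma half_point_in_cube:
  assumes "h \<in> corners d"
  shows "half_point d h \<in> cube d"
proof -
  have "h i \<in> {0, 1}" if "i \<in> {1..d}" for i
    using PiE_mem[OF assms[unfolded corners_def] that] .
  hence "real_of_int (h i) / 2 \<in> {0..1}" if "i \<in> {1..d}" for i
    using that by force
  thus ?thesis unfolding half_point_def cube_def by auto
qed

text \<open>
  In one coordinate the sum is $1 + e^{\pi\mathrm{i}k} = 1 + (-1)^k$, and the sum over the product set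
  factorizes. So averaging over the half points is aliasing: it retains exactly the even
  frequencies.
\<close>

lemma sum_character_half_points:
  "(\<Sum>h\<in>corners d. character d k (half_point d h)) = 2 ^ d * of_bool (\<forall>m\<in>{1..d}. even (k m))"
proof -
  have *: "exp (2 * of_real pi * \<i> * of_int j * of_real (of_int b / 2)) = (if b = 1 then (if even j then 1 else -1) else 1)"
    if "b \<in> {0, 1}" for b j :: int
  proof (cases "b = 1")
    case True
    show ?thesis
    proof (cases "even j")
      case True
      then obtain i where "j = 2 * i" by blast
      thus ?thesis using exp_integer_2pi[of "of_int i"] \<open>b = 1\<close> by (simp add: mult_ac)
    next
      case False
      then obtain i where "j = 2 * i + 1" using oddE by blast
      thus ?thesis using exp_integer_2pi[of "of_int i"] \<open>b = 1\<close>
        by (simp add: algebra_simps exp_add)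
    qed
  qed (use that in auto)
  have "(\<Sum>h\<in>corners d. character d k (half_point d h))
      = (\<Sum>h\<in>corners d. \<Prod>m=1..d. exp (2 * of_real pi * \<i> * of_int (k m) * of_real (of_int (h m) / 2)))"
    by (simp add: character_eq_prod half_point_def)
  also have "\<dots> = (\<Prod>m=1..d. \<Sum>b\<in>{0, 1}. exp (2 * of_real pi * \<i> * of_int (k m) * of_real (of_int b / 2)))"
    unfolding corners_def by (rule prod_sum_PiE[symmetric]) auto
  also have "\<dots> = (\<Prod>m=1..d. 2 * of_bool (even (k m)))"
    by (intro prod.cong refl) (simp add: * del: of_real_divide)
  also have "\<dots> = 2 ^ d * of_bool (\<forall>m\<in>{1..d}. even (k m))"
    by (auto simp: prod.distrib prod_zero_iff)
  finally show ?thesis .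
qed

text \<open>
  The one-dimensional factor of the largest possible Fourier coefficient on the unit ball, restricted
  to the frequencies that the rectangle rule does not annihilate.
\<close>

definition even_weight :: "real \<Rightarrow> int \<Rightarrow> real" where
  "even_weight \<alpha> j = (if even j then of_int (max 1 \<bar>j\<bar>) powr (-\<alpha>) else 0)"

lemma even_weight_nonneg: "even_weight \<alpha> j \<ge> 0"
  by (simp add: even_weight_def)

lemma zeta_sums:
  assumes "\<alpha> > 1"
  shows "(\<lambda>m. real (Suc m) powr (-\<alpha>)) sums zeta \<alpha>"
proof -
  have "summable (\<lambda>m. real m powr (-\<alpha>))"
    using assms by (simp add: summable_real_powr_iff)
  hence "summable (\<lambda>m. real (Suc m) powr (-\<alpha>))"
    by (subst summable_Suc_iff)
  thus ?thesis unfolding zeta_def by (rule summable_sums)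
qed

text \<open>
  The frequency $0$ contributes $1$, and the positive and the negative even frequencies contribute
  $\sum_{m \ge 1} (2m)^{-\alpha} = 2^{-\alpha}\zeta(\alpha)$ each.
\<close>

lemma has_sum_even_weight:
  assumes "\<alpha> > 1"
  shows "(even_weight \<alpha> has_sum (1 + zeta \<alpha> / 2 powr (\<alpha> - 1))) UNIV"
proof -
  \<comment> \<open>the sign \<open>s\<close> treats the two half-lines at once\<close>
  have tail: "(even_weight \<alpha> has_sum (2 powr (-\<alpha>) * zeta \<alpha>)) (range (\<lambda>m. s * (2 * int (Suc m))))"
    if s: "s \<in> {1, -1}" for s
  proof -
    have inj: "inj (\<lambda>m. s * (2 * int (Suc m)))"
      using s by (auto intro!: injI)
    have "even_weight \<alpha> (s * (2 * int (Suc m))) = 2 powr (-\<alpha>) * real (Suc m) powr (-\<alpha>)" for m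
    proof -
      have "max 1 \<bar>s * (2 * int (Suc m))\<bar> = 2 * int (Suc m)" using s by (auto simp: abs_mult)
      hence "even_weight \<alpha> (s * (2 * int (Suc m))) = (2 * real (Suc m)) powr (-\<alpha>)"
        by (simp add: even_weight_def del: of_nat_Suc)
      thus ?thesis by (simp only: powr_mult)
    qed
    moreover have "((\<lambda>m. 2 powr (-\<alpha>) * real (Suc m) powr (-\<alpha>)) has_sum (2 powr (-\<alpha>) * zeta \<alpha>)) UNIV"
      by (intro sums_nonneg_imp_has_sum sums_mult zeta_sums assms) auto
    ultimately show ?thesis
      by (subst has_sum_reindex[OF inj]) (simp add: o_def)
  qed
  let ?pos = "range (\<lambda>m. 1 * (2 * int (Suc m)))" and ?neg = "range (\<lambda>m. -1 * (2 * int (Suc m)))"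
  have "(even_weight \<alpha> has_sum (1 + (2 powr (-\<alpha>) * zeta \<alpha> + 2 powr (-\<alpha>) * zeta \<alpha>))) ({0} \<union> (?pos \<union> ?neg))"
  proof (intro has_sum_Un_disjoint tail)
    show "(even_weight \<alpha> has_sum 1) {0}"
      by (intro has_sum_finiteI) (auto simp: even_weight_def)
  qed auto
  moreover have "2 powr (-\<alpha>) * zeta \<alpha> + 2 powr (-\<alpha>) * zeta \<alpha> = zeta \<alpha> / 2 powr (\<alpha> - 1)"
    by (simp add: powr_diff powr_minus_divide field_simps)
  moreover have "even_weight \<alpha> j = 0" if "j \<in> UNIV - ({0} \<union> (?pos \<union> ?neg))" for j
  proof (rule ccontr)
    assume "even_weight \<alpha> j \<noteq> 0"
    then obtain i where i: "j = 2 * i" by (auto simp: even_weight_def split: if_splits)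
    show False
    proof (cases i rule: int_cases3)
      case zero
      thus ?thesis using that i by simp
    next
      case (pos n)
      hence "j = 1 * (2 * int (Suc (n - 1)))" using i by simp
      thus ?thesis using that by blast
    next
      case (neg n)
      hence "j = -1 * (2 * int (Suc (n - 1)))" using i by simp
      thus ?thesis using that by blast
    qed
  qed
  ultimately show ?thesis
    by (subst has_sum_cong_neutral[where T = "{0} \<union> (?pos \<union> ?neg)" and g = "even_weight \<alpha>"]) auto
qed

lemma has_sum_prod_even_weight:
  assumes "\<alpha> > 1"
  shows "((\<lambda>k. \<Prod>m=1..d. even_weight \<alpha> (k m)) has_sum (1 + zeta \<alpha> / 2 powr (\<alpha> - 1)) ^ d) (freqs d)"
proof -
  have summable: "(\<lambda>j. norm (even_weight \<alpha> j)) summable_on UNIV"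
    using has_sum_even_weight[OF assms] by (auto simp: even_weight_nonneg summable_on_def)
  have "(\<lambda>k. norm (\<Prod>m=1..d. even_weight \<alpha> (k m))) summable_on freqs d"
    unfolding freqs_def abs_summable_equivalent
    by (rule abs_summable_on_prod_PiE) (use summable[unfolded abs_summable_equivalent] in auto)
  hence "(\<lambda>k. \<Prod>m=1..d. even_weight \<alpha> (k m)) summable_on freqs d"
    by (rule abs_summable_summable)
  moreover have "(\<Sum>\<^sub>\<infinity>k\<in>freqs d. \<Prod>m=1..d. even_weight \<alpha> (k m)) = (\<Prod>m=1..d. infsum (even_weight \<alpha>) UNIV)"
    unfolding freqs_def by (rule infsum_prod_PiE_abs) (use summable in auto)
  moreover have "infsum (even_weight \<alpha>) UNIV = 1 + zeta \<alpha> / 2 powr (\<alpha> - 1)"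
    using has_sum_even_weight[OF assms] by (rule infsumI)
  ultimately show ?thesis by (simp add: has_sum_iff)
qed

lemma has_sum_sum:
  fixes f :: "'i \<Rightarrow> 'a \<Rightarrow> 'b::topological_comm_monoid_add"
  assumes "finite H" "\<And>h. h \<in> H \<Longrightarrow> (f h has_sum s h) A"
  shows "((\<lambda>k. \<Sum>h\<in>H. f h k) has_sum (\<Sum>h\<in>H. s h)) A"
  using assms by (induction H rule: finite_induct) (auto intro!: has_sum_add)

text \<open>
  Summing the Fourier series over the half points shows that the rule returns the sum of the
  coefficients at even frequencies. Its term at frequency zero is the integral, and subtracting it
  accounts for the $-1$ in the bound.
\<close>

lemma rectangle_rule_error:
  assumes \<alpha>: "\<alpha> > 1" and f: "f \<in> korobov_space d \<alpha>" "korobov_norm d \<alpha> f \<le> 1"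
  shows "norm (Int_cube d f - (\<Sum>h\<in>corners d. f (half_point d h)) / 2 ^ d)
           \<le> (1 + zeta \<alpha> / 2 powr (\<alpha> - 1)) ^ d - 1"
proof -
  let ?Q = "(\<Sum>h\<in>corners d. f (half_point d h)) / 2 ^ d"
  let ?even = "\<lambda>k. \<forall>m\<in>{1..d}. even (k m :: int)"
  let ?z = "zero_freq d"
  let ?w = "\<lambda>k. \<Prod>m=1..d. even_weight \<alpha> (k m)"
  have z: "?z \<in> freqs d" by (simp add: freqs_def)
  have "((\<lambda>k. fourier_coeff d f k * character d k (half_point d h)) has_sum f (half_point d h)) (freqs d)"
    if "h \<in> corners d" for h
    using f(1) half_point_in_cube[OF that] by (simp add: korobov_space_def character_def)
  hence "((\<lambda>k. \<Sum>h\<in>corners d. fourier_coeff d f k * character d k (half_point d h))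
      has_sum (\<Sum>h\<in>corners d. f (half_point d h))) (freqs d)"
    by (intro has_sum_sum) auto
  hence "((\<lambda>k. (\<Sum>h\<in>corners d. fourier_coeff d f k * character d k (half_point d h)) / 2 ^ d)
      has_sum ?Q) (freqs d)"
    by (rule has_sum_divide_const)
  hence Q: "((\<lambda>k. fourier_coeff d f k * of_bool (?even k)) has_sum ?Q) (freqs d)"
    by (simp add: sum_distrib_left[symmetric] sum_character_half_points)
  have "((\<lambda>k. if k = ?z then fourier_coeff d f ?z else 0) has_sum Int_cube d f) (freqs d)"
    using z by (intro has_sum_finite_neutralI[of "{?z}"]) (auto simp: Int_cube_eq_fourier_coeff)
  from has_sum_add[OF this has_sum_uminusI[OF Q]]
  have diff: "((\<lambda>k. (if k = ?z then fourier_coeff d f ?z else 0) - fourier_coeff d f k * of_bool (?even k))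
      has_sum (Int_cube d f - ?Q)) (freqs d)" by simp
  have "((\<lambda>k. if k = ?z then 1 else 0) has_sum (1::real)) (freqs d)"
    using z by (intro has_sum_finite_neutralI[of "{?z}"]) auto
  from has_sum_add[OF has_sum_prod_even_weight[OF \<alpha>] has_sum_uminusI[OF this]]
  have weight: "((\<lambda>k. ?w k - (if k = ?z then 1 else 0))
      has_sum ((1 + zeta \<alpha> / 2 powr (\<alpha> - 1)) ^ d - 1)) (freqs d)" by simp
  show ?thesis
  proof (rule norm_infsum_le[OF diff weight])
    fix k assume k: "k \<in> freqs d"
    have w_even: "?w k = (\<Prod>m=1..d. of_int (max 1 \<bar>k m\<bar>)) powr (-\<alpha>)" if "?even k"
    proof -
      have "?w k = (\<Prod>m=1..d. of_int (max 1 \<bar>k m\<bar>) powr (-\<alpha>))"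
        using that by (intro prod.cong) (auto simp: even_weight_def)
      also have "\<dots> = (\<Prod>m=1..d. of_int (max 1 \<bar>k m\<bar>)) powr (-\<alpha>)"
        by (rule prod_powr_distrib[symmetric])
      finally show ?thesis .
    qed
    show "norm ((if k = ?z then fourier_coeff d f ?z else 0) - fourier_coeff d f k * of_bool (?even k))
        \<le> ?w k - (if k = ?z then 1 else 0)"
    proof (cases "k = ?z")
      case True
      thus ?thesis by (simp add: even_weight_def)
    next
      case False
      have "0 \<le> ?w k" by (intro prod_nonneg) (simp add: even_weight_nonneg)
      moreover have "norm (fourier_coeff d f k) \<le> ?w k" if "?even k"
        using norm_fourier_coeff_le[OF f(2) k] w_even[OF that] by simp
      ultimately show ?thesis using False by simp
    qed
  qed
qed

text \<open>
  One node per orbit, weighted by the size of the orbit. Permuting coordinates commutes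
  with \<open>half_point\<close>, so a symmetric function takes one value on each orbit of nodes.
\<close>

lemma rectangle_rule_as_cubature:
  assumes I: "I \<subseteq> {1..d}"
  obtains w t where "\<And>n. n \<in> {1..N_star d I} \<Longrightarrow> t n \<in> cube d"
    "\<And>f F. f \<in> perm_invariant d I F \<Longrightarrow>
       cubature (N_star d I) w t f = (\<Sum>h\<in>corners d. f (half_point d h)) / 2 ^ d"
proof -
  let ?type = "orbit_type d I" and ?N = "N_star d I"
  have "finite (?type ` corners d)" by simp
  then obtain e where e: "bij_betw e {1..?N} (?type ` corners d)"
    using ex_bij_betw_nat_finite_1[of "?type ` corners d"] card_orbit_types[OF I] by auto
  define rep where "rep c = (SOME h. h \<in> corners d \<and> ?type h = c)" for c
  have rep: "rep c \<in> corners d" "?type (rep c) = c" if "c \<in> ?type ` corners d" for c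
    using someI_ex[of "\<lambda>h. h \<in> corners d \<and> ?type h = c"] that unfolding rep_def by auto
  define w :: "nat \<Rightarrow> complex" where "w n = of_nat (card {h\<in>corners d. ?type h = e n}) / 2 ^ d" for n
  define t where "t n = half_point d (rep (e n))" for n
  show ?thesis
  proof
    fix n assume "n \<in> {1..?N}"
    hence "e n \<in> ?type ` corners d" using e by (auto simp: bij_betw_def simp del: atLeastAtMost_iff)
    thus "t n \<in> cube d" unfolding t_def by (intro half_point_in_cube rep)
  next
    fix f F assume f: "f \<in> perm_invariant d I F"
    have same: "f (half_point d (rep (?type h))) = f (half_point d h)" if h: "h \<in> corners d" for h
    proof -
      have r: "rep (?type h) \<in> corners d" "?type (rep (?type h)) = ?type h"
        using rep[of "?type h"] h by auto
      obtain \<sigma> where \<sigma>: "\<sigma> permutes I" "rep (?type h) = permute_coords d \<sigma> h"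
        using same_orbit_type_imp_permuted[OF I r(1) h r(2)] by blast
      have "half_point d (permute_coords d \<sigma> h) = permute_coords d \<sigma> (half_point d h)"
        using permutes_in_image[OF permutes_superset_cube[OF I \<sigma>(1)]]
        by (auto simp: half_point_def fun_eq_iff simp del: atLeastAtMost_iff)
      moreover have "f (half_point d h) = f (permute_coords d \<sigma> (half_point d h))"
        using f \<sigma>(1) half_point_in_cube[OF h] unfolding perm_invariant_def coord_perms_eq[OF I] by blast
      ultimately show ?thesis using \<sigma>(2) by simp
    qed
    have "cubature ?N w t f
        = (\<Sum>n=1..?N. of_nat (card {h\<in>corners d. ?type h = e n}) / 2 ^ d * f (half_point d (rep (e n))))"
      by (simp add: cubature_def w_def t_def)
    also have "\<dots> = (\<Sum>c\<in>?type ` corners d.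
        of_nat (card {h\<in>corners d. ?type h = c}) / 2 ^ d * f (half_point d (rep c)))"
      by (rule sum.reindex_bij_betw[OF e])
    also have "\<dots> = (\<Sum>c\<in>?type ` corners d. \<Sum>h\<in>{h\<in>corners d. ?type h = c}. f (half_point d h) / 2 ^ d)"
    proof (rule sum.cong)
      fix c
      have "(\<Sum>h\<in>{h\<in>corners d. ?type h = c}. f (half_point d h) / 2 ^ d)
          = (\<Sum>h\<in>{h\<in>corners d. ?type h = c}. f (half_point d (rep c)) / 2 ^ d)"
        using same by (intro sum.cong) auto
      thus "of_nat (card {h\<in>corners d. ?type h = c}) / 2 ^ d * f (half_point d (rep c))
          = (\<Sum>h\<in>{h\<in>corners d. ?type h = c}. f (half_point d h) / 2 ^ d)"
        by simp
    qed simp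
    also have "\<dots> = (\<Sum>h\<in>corners d. f (half_point d h) / 2 ^ d)"
      by (rule sum.image_gen[symmetric]) simp
    finally show "cubature ?N w t f = (\<Sum>h\<in>corners d. f (half_point d h)) / 2 ^ d"
      by (simp add: sum_divide_distrib)
  qed
qed

lemma korobov_error_N_star_le:
  assumes I: "I \<subseteq> {1..d}" and \<alpha>: "\<alpha> > 1"
  shows "korobov_error (N_star d I) d I \<alpha> \<le> ereal ((1 + zeta \<alpha> / 2 powr (\<alpha> - 1)) ^ d - 1)"
proof -
  obtain w t where wt: "\<And>n. n \<in> {1..N_star d I} \<Longrightarrow> t n \<in> cube d"
    "\<And>f F. f \<in> perm_invariant d I F \<Longrightarrow>
       cubature (N_star d I) w t f = (\<Sum>h\<in>corners d. f (half_point d h)) / 2 ^ d"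
    using rectangle_rule_as_cubature[OF I] by metis
  show ?thesis
    unfolding korobov_error_def min_error_def
  proof (rule INF_lower2[of "(w, t)"])
    show "(case (w, t) of (w, t) \<Rightarrow>
            SUP f\<in>{f \<in> perm_invariant d I (korobov_space d \<alpha>). korobov_norm d \<alpha> f \<le> 1}.
              ereal (norm (Int_cube d f - cubature (N_star d I) w t f)))
          \<le> ereal ((1 + zeta \<alpha> / 2 powr (\<alpha> - 1)) ^ d - 1)"
      unfolding prod.case
    proof (rule SUP_least)
      fix f assume f: "f \<in> {f \<in> perm_invariant d I (korobov_space d \<alpha>). korobov_norm d \<alpha> f \<le> 1}"
      hence "f \<in> korobov_space d \<alpha>" "korobov_norm d \<alpha> f \<le> 1" by (auto simp: perm_invariant_def)
      from rectangle_rule_error[OF \<alpha> this]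
      show "ereal (norm (Int_cube d f - cubature (N_star d I) w t f))
          \<le> ereal ((1 + zeta \<alpha> / 2 powr (\<alpha> - 1)) ^ d - 1)"
        using f wt(2) by auto
    qed
  qed (use wt in auto)
qed

lemma zeta_nonneg: "\<alpha> > 1 \<Longrightarrow> zeta \<alpha> \<ge> 0"
  using sums_le[OF _ sums_zero zeta_sums] by auto

lemma zeta_antimono:
  assumes "1 < \<alpha>" "\<alpha> \<le> \<beta>"
  shows "zeta \<beta> \<le> zeta \<alpha>"
proof (rule sums_le)
  show "real (Suc m) powr (-\<beta>) \<le> real (Suc m) powr (-\<alpha>)" for m
    using assms by (intro powr_mono) auto
  show "(\<lambda>m. real (Suc m) powr (-\<beta>)) sums zeta \<beta>" "(\<lambda>m. real (Suc m) powr (-\<alpha>)) sums zeta \<alpha>"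
    using assms by (auto intro: zeta_sums simp del: of_nat_Suc)
qed

text \<open>
  For $\alpha \ge 2$ the numerator is at most $\zeta(2)$, so the denominator wins.
\<close>

lemma error_bound_tendsto_0:
  "((\<lambda>\<alpha>. (1 + zeta \<alpha> / 2 powr (\<alpha> - 1)) ^ d - 1) \<longlongrightarrow> 0) at_top"
proof -
  have lim: "((\<lambda>\<alpha>. zeta 2 / 2 powr (\<alpha> - 1)) \<longlongrightarrow> 0) at_top"
    by real_asymp
  have "((\<lambda>\<alpha>. zeta \<alpha> / 2 powr (\<alpha> - 1)) \<longlongrightarrow> 0) at_top"
  proof (rule tendsto_sandwich[OF _ _ tendsto_const lim])
    show "\<forall>\<^sub>F \<alpha> in at_top. 0 \<le> zeta \<alpha> / 2 powr (\<alpha> - 1)"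
      using eventually_gt_at_top[of 1] by eventually_elim (simp add: zeta_nonneg)
    show "\<forall>\<^sub>F \<alpha> in at_top. zeta \<alpha> / 2 powr (\<alpha> - 1) \<le> zeta 2 / 2 powr (\<alpha> - 1)"
      using eventually_ge_at_top[of 2] by eventually_elim (intro divide_right_mono zeta_antimono, auto)
  qed
  hence "((\<lambda>\<alpha>. (1 + zeta \<alpha> / 2 powr (\<alpha> - 1)) ^ d - 1) \<longlongrightarrow> (1 + 0) ^ d - 1) at_top"
    by (intro tendsto_intros)
  thus ?thesis by simp
qed

lemma korobov_error_tendsto_0:
  assumes "I \<subseteq> {1..d}"
  shows "((\<lambda>\<alpha>. korobov_error (N_star d I) d I \<alpha>) \<longlongrightarrow> 0) at_top"
proof (rule tendsto_sandwich[OF _ _ tendsto_const])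
  show "((\<lambda>\<alpha>. ereal ((1 + zeta \<alpha> / 2 powr (\<alpha> - 1)) ^ d - 1)) \<longlongrightarrow> 0) at_top"
    using error_bound_tendsto_0 unfolding zero_ereal_def by (intro tendsto_ereal)
  show "\<forall>\<^sub>F \<alpha> in at_top. korobov_error (N_star d I) d I \<alpha> \<le> ereal ((1 + zeta \<alpha> / 2 powr (\<alpha> - 1)) ^ d - 1)"
    using eventually_gt_at_top[of 1] by eventually_elim (rule korobov_error_N_star_le[OF assms])
qed (auto simp: korobov_error_nonneg)

theorem theorem1:
  fixes I :: "nat \<Rightarrow> nat set"
  assumes "\<And>d. d \<ge> 1 \<Longrightarrow> I d \<subseteq> {1..d}"
  shows "(\<forall>d\<ge>1. \<forall>\<alpha>>1.
            (\<forall>N < N_star d (I d). korobov_error N d (I d) \<alpha> = 1) \<and>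
            korobov_error (N_star d (I d)) d (I d) \<alpha>
              \<le> ereal ((1 + zeta \<alpha> / 2 powr (\<alpha> - 1)) ^ d - 1)) \<and>
         (\<forall>d\<ge>1. ((\<lambda>\<alpha>. korobov_error (N_star d (I d)) d (I d) \<alpha>) \<longlongrightarrow> 0) at_top)"
  using assms korobov_error_eq_1 korobov_error_N_star_le korobov_error_tendsto_0 by simp

end
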